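(* There is an absolute constant $c > 0$ such that for every natural number $n$ and every positive Borel probability measure $\mu$ supported on $\mathcal{K}_n$, the $n$-th generation of the four-corner Cantor set, $$I_1(\mu) \ge c\, n.$$
   Context: The Riesz $1$-energy of a positive Borel measure $\mu$ on $\mathbb{R}^2$ is $I_1(\mu) = \iint \frac{d\mu(x)\, d\mu(y)}{|x-y|} \in [0,\infty]$, where the integrand is $+\infty$ when $x=y$. The sets $\mathcal{K}_n \subset \mathbb{R}^2$ are defined recursively: $\mathcal{K}_0 = [0,1]^2$; given $\mathcal{K}_n$, which is a union of $4^n$ disjoint closed axis-parallel squares of sidelength $4^{-n}$, divide each of these squares into $16$ equal closed squares of sidelength $4^{-n-1}$ (a $4 \times 4$ grid) and keep the four squares at the corners; $\mathcal{K}_{n+1}$ is the union of all squares kept. *)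

theory Defs
  imports "HOL-Probability.Probability"
begin

text \<open>The plane is \<^typ>\<open>real \<times> real\<close>, whose \<^const>\<open>dist\<close> is the Euclidean distance.
  In \<^typ>\<open>ennreal\<close> we have \<open>inverse 0 = \<infinity>\<close>, so the integrand is infinite on the diagonal.\<close>

definition riesz_energy_1 :: "(real \<times> real) measure \<Rightarrow> ennreal" where
  "riesz_energy_1 \<mu> = (\<integral>\<^sup>+ x. (\<integral>\<^sup>+ y. inverse (ennreal (dist x y)) \<partial>\<mu>) \<partial>\<mu>)"

definition closed_square :: "real \<Rightarrow> real \<times> real \<Rightarrow> (real \<times> real) set" where
  "closed_square s p = {fst p .. fst p + s} \<times> {snd p .. snd p + s}"

text \<open>The set of lower left vertices of the \<open>4 ^ n\<close> squares of generation \<open>n\<close>. The cells of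
  the \<open>4 \<times> 4\<close> grid in a square with lower left vertex \<open>(a, b)\<close> and side \<open>4 * s\<close> have lower left
  vertices \<open>(a + i * s, b + j * s)\<close> with \<open>i, j \<in> {0, 1, 2, 3}\<close>; the corner cells are those with
  \<open>i, j \<in> {0, 3}\<close>.\<close>

primrec corner_vertices :: "nat \<Rightarrow> (real \<times> real) set" where
  "corner_vertices 0 = {(0, 0)}"
| "corner_vertices (Suc n) =
    {(a + i * (1 / 4) ^ Suc n, b + j * (1 / 4) ^ Suc n) | a b i j.
      (a, b) \<in> corner_vertices n \<and> i \<in> {0, 3} \<and> j \<in> {0, 3}}"

definition four_corner_set :: "nat \<Rightarrow> (real \<times> real) set" where
  "four_corner_set n = (\<Union>p\<in>corner_vertices n. closed_square ((1 / 4) ^ n) p)"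

end

theory Submission
  imports Defs
begin

text \<open>The energy is bounded below by one unit per scale. Two points in a common generation-\<open>k\<close>
  square have distance at most \<open>2 / 4 ^ k\<close>, so for \<open>x \<noteq> y\<close> each scale \<open>k\<close> at which they share a
  square has \<open>4 ^ k \<le> 2 / dist x y\<close>; since a geometric sum is comparable to its largest term,
  the Riesz kernel dominates, up to a factor \<open>4\<close>, the sum over all scales \<open>k\<close> of \<open>4 ^ k\<close> times
  the indicator that \<open>x\<close> and \<open>y\<close> share a generation-\<open>k\<close> square
  (\<open>multiscale_kernel_le\<close>). This uses that squares of one generation are disjoint
  (\<open>generation_squares_disjoint\<close>).

  The double integral of the scale-\<open>k\<close> term is \<open>4 ^ k * (\<Sum>Q. \<mu> Q ^ 2)\<close>. There are at most
  \<open>4 ^ k\<close> squares \<open>Q\<close>, and their masses sum to at least \<open>1\<close>, so Cauchy--Schwarz bounds it below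
  by \<open>1\<close> (\<open>generation_energy_ge_1\<close>). Summing over \<open>k < n\<close> gives the theorem with
  \<open>c = 1 / 4\<close>.\<close>

section \<open>Geometry of the generations\<close>

lemma corner_vertices_Suc_image:
  "corner_vertices (Suc n) =
    (\<lambda>((a, b), i, j). (a + i * (1 / 4) ^ Suc n, b + j * (1 / 4) ^ Suc n)) `
      (corner_vertices n \<times> {0, 3} \<times> {0, 3})"
  unfolding corner_vertices.simps
  by (simp only: image_def Bex_def split_paired_Ex mem_Times_iff prod.case fst_conv snd_conv) blast

lemma finite_corner_vertices: "finite (corner_vertices n)"
proof (induction n)
  case (Suc n)
  then show ?case
    unfolding corner_vertices_Suc_image by (intro finite_imageI finite_cartesian_product) auto
qed simp

lemma card_corner_vertices_le: "card (corner_vertices n) \<le> 4 ^ n"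
proof (induction n)
  case (Suc n)
  have "card (corner_vertices (Suc n)) \<le> card (corner_vertices n \<times> {0, 3::real} \<times> {0, 3::real})"
    unfolding corner_vertices_Suc_image
    by (intro card_image_le finite_cartesian_product finite_corner_vertices) auto
  also have "\<dots> = 4 * card (corner_vertices n)"
    by (simp add: card_cartesian_product)
  finally show ?case
    using Suc by simp
qed simp

text \<open>Writing \<open>s\<close> for the new side length, siblings are separated by \<open>3 * s\<close> in some coordinate,
  while descendants of different squares keep \<open>2 * (4 * s) - 3 * s = 5 * s\<close> of the separation of
  their parents. The constant \<open>2\<close> thus reproduces itself, and anything above \<open>1\<close> makes the
  squares disjoint.\<close>

lemma corner_vertices_separated:
  assumes "p \<in> corner_vertices n" "q \<in> corner_vertices n" "p \<noteq> q"
  shows "\<bar>fst p - fst q\<bar> \<ge> 2 * (1 / 4) ^ n \<or> \<bar>snd p - snd q\<bar> \<ge> 2 * (1 / 4) ^ n"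
  using assms
proof (induction n arbitrary: p q)
  case (Suc n)
  define s :: real where "s = (1 / 4) ^ Suc n"
  have s: "s > 0" "(1 / 4) ^ n = 4 * s"
    by (simp_all add: s_def)
  obtain a b i j where p: "p = (a + i * s, b + j * s)" "(a, b) \<in> corner_vertices n"
    and ij: "i \<in> {0, 3}" "j \<in> {0, 3}"
    using Suc.prems(1) unfolding s_def by auto
  obtain a' b' i' j' where q: "q = (a' + i' * s, b' + j' * s)" "(a', b') \<in> corner_vertices n"
    and ij': "i' \<in> {0, 3}" "j' \<in> {0, 3}"
    using Suc.prems(2) unfolding s_def by auto
  have "\<bar>fst p - fst q\<bar> \<ge> 2 * s \<or> \<bar>snd p - snd q\<bar> \<ge> 2 * s"
  proof (cases "(a, b) = (a', b')")
    case True
    then have "i \<noteq> i' \<or> j \<noteq> j'"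
      using p q Suc.prems(3) by auto
    then show ?thesis
      using True p q ij ij' s by auto
  next
    case False
    then have "\<bar>a - a'\<bar> \<ge> 8 * s \<or> \<bar>b - b'\<bar> \<ge> 8 * s"
      using Suc.IH[OF p(2) q(2)] s by auto
    moreover have "\<bar>i * s - i' * s\<bar> \<le> 3 * s" "\<bar>j * s - j' * s\<bar> \<le> 3 * s"
      using ij ij' s by auto
    ultimately show ?thesis
      using p q s(1) by simp linarith
  qed
  then show ?case
    by (simp add: s_def)
qed simp

lemma generation_squares_disjoint:
  assumes "p \<in> corner_vertices n" "q \<in> corner_vertices n"
    and "x \<in> closed_square ((1 / 4) ^ n) p" "x \<in> closed_square ((1 / 4) ^ n) q"
  shows "p = q"
proof (rule ccontr)
  assume "p \<noteq> q"
  moreover have "\<bar>fst p - fst q\<bar> \<le> (1 / 4) ^ n" "\<bar>snd p - snd q\<bar> \<le> (1 / 4) ^ n"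
    using assms(3,4) by (auto simp: closed_square_def mem_Times_iff)
  moreover have "(1 / 4 :: real) ^ n > 0"
    by simp
  ultimately show False
    using corner_vertices_separated[OF assms(1,2)] by linarith
qed

lemma four_corner_set_Suc_subset: "four_corner_set (Suc n) \<subseteq> four_corner_set n"
proof
  fix x assume "x \<in> four_corner_set (Suc n)"
  define s :: real where "s = (1 / 4) ^ Suc n"
  have s: "s > 0" "(1 / 4) ^ n = 4 * s"
    by (simp_all add: s_def)
  obtain p where p: "p \<in> corner_vertices (Suc n)" "x \<in> closed_square s p"
    using \<open>x \<in> four_corner_set (Suc n)\<close> unfolding s_def four_corner_set_def by blast
  obtain a b i j where "p = (a + i * s, b + j * s)" and ab: "(a, b) \<in> corner_vertices n"
    and "i \<in> {0, 3}" "j \<in> {0, 3}"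
    using p(1) unfolding s_def by auto
  then have "x \<in> closed_square (4 * s) (a, b)"
    using p(2) s by (auto simp: closed_square_def)
  then show "x \<in> four_corner_set n"
    using ab by (auto simp: four_corner_set_def s)
qed

lemma antimono_four_corner_set: "m \<le> n \<Longrightarrow> four_corner_set n \<subseteq> four_corner_set m"
  by (rule lift_Suc_antimono_le[of four_corner_set]) (rule four_corner_set_Suc_subset)

section \<open>The kernel as a sum over scales\<close>

lemma dist_closed_square_le:
  assumes "x \<in> closed_square s p" "y \<in> closed_square s p"
  shows "dist x y \<le> 2 * s"
proof -
  have "dist x y \<le> dist (fst x) (fst y) + dist (snd x) (snd y)"
    by (simp add: dist_prod_def sqrt_sum_squares_le_sum)
  also have "\<dots> \<le> s + s"
    using assms by (intro add_mono) (auto simp: closed_square_def dist_real_def)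
  finally show ?thesis by simp
qed

lemma sum_powers_of_4_le:
  fixes M :: real
  assumes "finite A" "\<And>k. k \<in> A \<Longrightarrow> 4 ^ k \<le> M" "M \<ge> 0"
  shows "(\<Sum>k\<in>A. 4 ^ k) \<le> 2 * M"
proof (cases "A = {}")
  case False
  have geometric: "(\<Sum>k\<le>m. 4 ^ k :: real) \<le> 2 * 4 ^ m" for m :: nat
  proof (induction m)
    case (Suc m)
    then have "(\<Sum>k\<le>Suc m. 4 ^ k :: real) \<le> 2 * 4 ^ m + 4 ^ Suc m"
      by simp
    also have "\<dots> \<le> 2 * 4 ^ Suc m"
      by simp
    finally show ?case .
  qed simp
  have "(\<Sum>k\<in>A. 4 ^ k :: real) \<le> (\<Sum>k\<le>Max A. 4 ^ k)"
    using assms(1) by (intro sum_mono2) auto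
  also have "\<dots> \<le> 2 * 4 ^ Max A"
    by (rule geometric)
  also have "\<dots> \<le> 2 * M"
    using assms(2)[OF Max_in[OF assms(1) False]] by simp
  finally show ?thesis .
qed (use assms in simp)

text \<open>By disjointness this is the indicator that two points lie in a common square of generation
  \<open>k\<close>; the form of a sum over the squares lets its double integral be taken term by term.\<close>

definition same_square :: "nat \<Rightarrow> real \<times> real \<Rightarrow> real \<times> real \<Rightarrow> ennreal" where
  "same_square k x y =
    (\<Sum>p\<in>corner_vertices k. indicator (closed_square ((1 / 4) ^ k) p) x *
      indicator (closed_square ((1 / 4) ^ k) p) y)"

lemma same_square_cases:
  obtains "same_square k x y = 0"
  | "same_square k x y = 1" and "dist x y \<le> 2 / 4 ^ k"
proof (cases "\<exists>p\<in>corner_vertices k.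
    x \<in> closed_square ((1 / 4) ^ k) p \<and> y \<in> closed_square ((1 / 4) ^ k) p")
  case False
  then have "same_square k x y = 0"
    unfolding same_square_def by (intro sum.neutral) (auto simp: indicator_def)
  then show ?thesis
    by (rule that)
next
  case True
  then obtain p where p: "p \<in> corner_vertices k"
    "x \<in> closed_square ((1 / 4) ^ k) p" "y \<in> closed_square ((1 / 4) ^ k) p"
    by blast
  have "same_square k x y = (\<Sum>q\<in>corner_vertices k. if q = p then 1 else 0)"
    unfolding same_square_def
  proof (rule sum.cong[OF refl])
    fix q assume "q \<in> corner_vertices k"
    then have "x \<notin> closed_square ((1 / 4) ^ k) q" if "q \<noteq> p"
      using generation_squares_disjoint p(1,2) that by blast
    then show "indicator (closed_square ((1 / 4) ^ k) q) x *
        indicator (closed_square ((1 / 4) ^ k) q) y = (if q = p then 1 else 0 :: ennreal)"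
      using p(2,3) by (cases "q = p") simp_all
  qed
  also have "\<dots> = 1"
    using p(1) by (simp add: finite_corner_vertices)
  finally show ?thesis
    using that(2) dist_closed_square_le[OF p(2,3)] by (simp add: power_divide)
qed

text \<open>The scales at which \<open>x \<noteq> y\<close> share a square contribute distinct powers of \<open>4\<close>, each at most
  \<open>2 / dist x y\<close>, so their sum is at most twice that bound. On the diagonal the right-hand side
  is infinite.\<close>

lemma multiscale_kernel_le:
  "(\<Sum>k<n. 4 ^ k * same_square k x y) \<le> 4 * inverse (ennreal (dist x y))"
proof (cases "x = y")
  case True
  then show ?thesis
    by (simp add: ennreal_mult_top)
next
  case False
  define A where "A = {k. k < n \<and> same_square k x y \<noteq> 0}"
  have "(\<Sum>k<n. 4 ^ k * same_square k x y) = (\<Sum>k\<in>A. 4 ^ k)"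
  proof (rule sum.mono_neutral_cong_right)
    show "4 ^ k * same_square k x y = 4 ^ k" if "k \<in> A" for k
      using that by (cases rule: same_square_cases[of k x y]) (auto simp: A_def)
  qed (auto simp: A_def)
  also have "\<dots> = ennreal (\<Sum>k\<in>A. 4 ^ k)"
    by (simp flip: sum_ennreal ennreal_power)
  also have "\<dots> \<le> ennreal (2 * (2 / dist x y))"
  proof (intro ennreal_leI sum_powers_of_4_le)
    show "finite A"
      by (simp add: A_def)
    show "4 ^ k \<le> 2 / dist x y" if "k \<in> A" for k
      using that False by (cases rule: same_square_cases[of k x y]) (auto simp: A_def field_simps)
  qed simp
  also have "\<dots> = 4 * inverse (ennreal (dist x y))"
    using False by (simp add: inverse_ennreal divide_inverse ennreal_mult')
  finally show ?thesis .
qed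

section \<open>The energy of one generation\<close>

lemma closed_square_borel: "closed_square s p \<in> sets borel"
  unfolding closed_square_def by (intro borel_closed closed_Times closed_atLeastAtMost)

lemma closed_square_sets: "sets \<mu> = sets borel \<Longrightarrow> closed_square s p \<in> sets \<mu>"
  by (simp add: closed_square_borel)

lemma measurable_same_square:
  assumes "sets \<mu> = sets borel"
  shows "same_square k x \<in> borel_measurable \<mu>"
  unfolding same_square_def
  by (intro borel_measurable_sum borel_measurable_times_ennreal borel_measurable_const
      borel_measurable_indicator closed_square_sets assms)

lemma nn_integral_same_square:
  assumes "sets \<mu> = sets borel"
  shows "(\<integral>\<^sup>+ y. same_square k x y \<partial>\<mu>) =
    (\<Sum>p\<in>corner_vertices k. emeasure \<mu> (closed_square ((1 / 4) ^ k) p) *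
      indicator (closed_square ((1 / 4) ^ k) p) x)"
proof -
  note [measurable] = closed_square_sets[OF assms]
  have "(\<integral>\<^sup>+ y. same_square k x y \<partial>\<mu>) =
    (\<Sum>p\<in>corner_vertices k. \<integral>\<^sup>+ y. indicator (closed_square ((1 / 4) ^ k) p) x *
      indicator (closed_square ((1 / 4) ^ k) p) y \<partial>\<mu>)"
    unfolding same_square_def by (rule nn_integral_sum) measurable
  also have "\<dots> = (\<Sum>p\<in>corner_vertices k. indicator (closed_square ((1 / 4) ^ k) p) x *
      emeasure \<mu> (closed_square ((1 / 4) ^ k) p))"
    by (intro sum.cong refl nn_integral_cmult_indicator closed_square_sets assms)
  finally show ?thesis
    by (simp only: mult.commute)
qed

lemma nn_integral_nn_integral_same_square:
  assumes "sets \<mu> = sets borel"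
  shows "(\<integral>\<^sup>+ x. (\<integral>\<^sup>+ y. same_square k x y \<partial>\<mu>) \<partial>\<mu>) =
    (\<Sum>p\<in>corner_vertices k. (emeasure \<mu> (closed_square ((1 / 4) ^ k) p))\<^sup>2)"
proof -
  note [measurable] = closed_square_sets[OF assms]
  have "(\<integral>\<^sup>+ x. (\<integral>\<^sup>+ y. same_square k x y \<partial>\<mu>) \<partial>\<mu>) =
    (\<Sum>p\<in>corner_vertices k. \<integral>\<^sup>+ x. emeasure \<mu> (closed_square ((1 / 4) ^ k) p) *
      indicator (closed_square ((1 / 4) ^ k) p) x \<partial>\<mu>)"
    unfolding nn_integral_same_square[OF assms] by (rule nn_integral_sum) measurable
  also have "\<dots> = (\<Sum>p\<in>corner_vertices k. (emeasure \<mu> (closed_square ((1 / 4) ^ k) p))\<^sup>2)"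
    unfolding power2_eq_square
    by (intro sum.cong refl nn_integral_cmult_indicator closed_square_sets assms)
  finally show ?thesis .
qed

text \<open>By Cauchy--Schwarz the sum of the squared masses of at most \<open>4 ^ k\<close> squares is smallest when
  the mass is spread evenly, and then it is at least \<open>1 / 4 ^ k\<close>.\<close>

lemma generation_energy_ge_1:
  assumes "prob_space \<mu>" and sets: "sets \<mu> = sets borel"
    and supp: "AE x in \<mu>. x \<in> four_corner_set k"
  shows "4 ^ k * (\<integral>\<^sup>+ x. (\<integral>\<^sup>+ y. same_square k x y \<partial>\<mu>) \<partial>\<mu>) \<ge> 1"
proof -
  interpret prob_space \<mu> by fact
  define m where "m p = measure \<mu> (closed_square ((1 / 4) ^ k) p)" for p
  have squares: "closed_square ((1 / 4) ^ k) p \<in> sets \<mu>" for p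
    by (rule closed_square_sets[OF sets])
  have "1 = prob (four_corner_set k)"
    using supp squares finite_corner_vertices
    by (subst eq_commute, subst prob_eq_1) (auto simp: four_corner_set_def)
  also have "\<dots> \<le> (\<Sum>p\<in>corner_vertices k. m p)"
    unfolding four_corner_set_def m_def using squares finite_corner_vertices
    by (intro finite_measure_subadditive_finite) auto
  finally have "1 \<le> (\<Sum>p\<in>corner_vertices k. m p)\<^sup>2"
    by simp
  also have "\<dots> \<le> (\<Sum>p\<in>corner_vertices k. (m p)\<^sup>2) * real (card (corner_vertices k))"
    by (rule sum_squared_le_sum_of_squares)
  also have "\<dots> \<le> (\<Sum>p\<in>corner_vertices k. (m p)\<^sup>2) * 4 ^ k"
    using of_nat_mono[OF card_corner_vertices_le[of k], where 'a = real]
    by (intro mult_left_mono sum_nonneg) simp_all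
  finally have "ennreal 1 \<le> ennreal (4 ^ k * (\<Sum>p\<in>corner_vertices k. (m p)\<^sup>2))"
    by (intro ennreal_leI) (simp add: mult.commute)
  also have "\<dots> = 4 ^ k * (\<Sum>p\<in>corner_vertices k. (emeasure \<mu> (closed_square ((1 / 4) ^ k) p))\<^sup>2)"
    by (simp add: ennreal_mult sum_nonneg emeasure_eq_measure m_def
        flip: sum_ennreal ennreal_power)
  finally show ?thesis
    by (simp add: nn_integral_nn_integral_same_square[OF sets])
qed

section \<open>The energy bound\<close>

theorem mainTheorem2:
  "\<exists>c::real. c > 0 \<and>
    (\<forall>(n::nat) (\<mu> :: (real \<times> real) measure).
      prob_space \<mu> \<longrightarrow> sets \<mu> = sets borel \<longrightarrow> (AE x in \<mu>. x \<in> four_corner_set n) \<longrightarrow>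
      riesz_energy_1 \<mu> \<ge> ennreal (c * real n))"
proof (intro exI[of _ "1 / 4 :: real"] conjI allI impI)
  fix n :: nat and \<mu> :: "(real \<times> real) measure"
  assume \<mu>: "prob_space \<mu>" and sets: "sets \<mu> = sets borel"
    and supp: "AE x in \<mu>. x \<in> four_corner_set n"
  note [measurable] = measurable_same_square[OF sets]
  have [measurable]: "(\<lambda>x. \<integral>\<^sup>+ y. same_square k x y \<partial>\<mu>) \<in> borel_measurable \<mu>" for k
    unfolding nn_integral_same_square[OF sets]
    by (intro borel_measurable_sum borel_measurable_times_ennreal borel_measurable_const
        borel_measurable_indicator closed_square_sets sets)
  have [measurable]: "(\<lambda>y. inverse (ennreal (dist x y))) \<in> borel_measurable \<mu>" for x
    unfolding measurable_cong_sets[OF sets refl] by measurable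
  have [measurable]: "(\<lambda>(x, y). inverse (ennreal (dist x y))) \<in> borel_measurable (\<mu> \<Otimes>\<^sub>M \<mu>)"
    unfolding measurable_cong_sets[OF sets_pair_measure_cong[OF sets sets] refl] by measurable
  interpret prob_space \<mu> by fact
  have "ennreal (real n) = (\<Sum>k<n. 1)"
    by (simp add: ennreal_of_nat_eq_real_of_nat)
  also have "\<dots> \<le> (\<Sum>k<n. 4 ^ k * (\<integral>\<^sup>+ x. (\<integral>\<^sup>+ y. same_square k x y \<partial>\<mu>) \<partial>\<mu>))"
  proof (rule sum_mono)
    fix k assume "k \<in> {..<n}"
    then have "four_corner_set n \<subseteq> four_corner_set k"
      by (intro antimono_four_corner_set) simp
    then have "AE x in \<mu>. x \<in> four_corner_set k"
      by (intro eventually_mono[OF supp]) blast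
    then show "1 \<le> 4 ^ k * (\<integral>\<^sup>+ x. (\<integral>\<^sup>+ y. same_square k x y \<partial>\<mu>) \<partial>\<mu>)"
      by (rule generation_energy_ge_1[OF \<mu> sets])
  qed
  also have "\<dots> = (\<integral>\<^sup>+ x. (\<integral>\<^sup>+ y. (\<Sum>k<n. 4 ^ k * same_square k x y) \<partial>\<mu>) \<partial>\<mu>)"
    by (simp add: nn_integral_sum nn_integral_cmult)
  also have "\<dots> \<le> (\<integral>\<^sup>+ x. 4 * (\<integral>\<^sup>+ y. inverse (ennreal (dist x y)) \<partial>\<mu>) \<partial>\<mu>)"
    by (subst nn_integral_cmult[symmetric], measurable)
      (intro nn_integral_mono multiscale_kernel_le)
  also have "\<dots> = 4 * riesz_energy_1 \<mu>"
    unfolding riesz_energy_1_def by (rule nn_integral_cmult) measurable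
  finally have "ennreal (1 / 4) * ennreal (real n) \<le> ennreal (1 / 4) * (4 * riesz_energy_1 \<mu>)"
    by (rule mult_left_mono) simp
  also have "\<dots> = ennreal (1 / 4 * 4) * riesz_energy_1 \<mu>"
    by (subst ennreal_mult) (simp_all add: mult.assoc)
  finally show "ennreal (1 / 4 * real n) \<le> riesz_energy_1 \<mu>"
    by (subst ennreal_mult) simp_all
qed simp

end
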